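(* Let $(L,\prec_1,\succ_1,\prec_2,\succ_2,\delta_1,\delta_2)$ be a compatible dendriDer pair. For $i\in\{1,2\}$ define the bilinear maps $\circ_i:L\times L\to L$ by $$x\circ_iy=x\succ_iy-y\prec_ix,\qquad x,y\in L.$$ Then $(L,\circ_1,\circ_2,\delta_1,\delta_2)$ is a compatible pre-LieDer pair.
   Context: All vector spaces are over a field $\mathbb{K}$ of characteristic $0$. A dendriform algebra $(L,\prec,\succ)$ is a vector space with two bilinear operations such that for all $x,y,z$: $(x\prec y)\prec z=x\prec(y\prec z+y\succ z)$, $(x\succ y)\prec z=x\succ(y\prec z)$, $x\succ(y\succ z)=(x\prec y+x\succ y)\succ z$. A dendriDer pair $(L,\prec,\succ,\delta)$ is a dendriform algebra with a linear map $\delta:L\to L$ that is a derivation for both $\prec$ and $\succ$. A compatible dendriform algebra $(L,\prec_1,\succ_1,\prec_2,\succ_2)$ consists of two dendriform algebras $(L,\prec_1,\succ_1)$ and $(L,\prec_2,\succ_2)$ such that for all $x,y,z\in L$: $(x\prec_1y)\prec_2z+(x\prec_2y)\prec_1z=x\prec_2(y\prec_1z+y\succ_1z)+x\prec_1(y\prec_2z+y\succ_2z)$, $(x\succ_1y)\prec_2z+(x\succ_2y)\prec_1z=x\succ_2(y\prec_1z)+x\succ_1(y\prec_2z)$, $(x\prec_1y+x\succ_1y)\succ_2z+(x\prec_2y+x\succ_2y)\succ_1z=x\succ_2(y\succ_1z)+x\succ_1(y\succ_2z)$. A compatible dendriDer pair $(L,\prec_1,\succ_1,\prec_2,\succ_2,\delta_1,\delta_2)$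 consists of two dendriDer pairs $(L,\prec_1,\succ_1,\delta_1)$ and $(L,\prec_2,\succ_2,\delta_2)$ such that $(L,\prec_1,\succ_1,\prec_2,\succ_2)$ is a compatible dendriform algebra and for all $x,y\in L$: $\delta_1(x\prec_2y)+\delta_2(x\prec_1y)=\delta_1x\prec_2y+x\prec_2\delta_1y+\delta_2x\prec_1y+x\prec_1\delta_2y$, $\delta_1(x\succ_2y)+\delta_2(x\succ_1y)=\delta_1x\succ_2y+x\succ_2\delta_1y+\delta_2x\succ_1y+x\succ_1\delta_2y$. A pre-Lie algebra $(L,\circ)$ is a vector space with a bilinear operation such that $(x\circ y)\circ z-x\circ(y\circ z)=(y\circ x)\circ z-y\circ(x\circ z)$. A pre-LieDer pair $(L,\circ,\delta)$ is a pre-Lie algebra with a linear map $\delta$ such that $\delta(x\circ y)=\delta x\circ y+x\circ\delta y$. A compatible pre-LieDer pair $(L,\circ_1,\circ_2,\delta_1,\delta_2)$ consists of two pre-LieDer pairs $(L,\circ_1,\delta_1)$, $(L,\circ_2,\delta_2)$ such that for all $x,y,z\in L$: $x\circ_1(y\circ_2z)+x\circ_2(y\circ_1z)-(x\circ_2y)\circ_1z-(x\circ_1y)\circ_2z=y\circ_1(x\circ_2z)+y\circ_2(x\circ_1z)-(y\circ_2x)\circ_1z-(y\circ_1x)\circ_2z$ and $\delta_1(x\circ_2y)+\delta_2(x\circ_1y)=\delta_1x\circ_2y+x\circ_2\delta_1y+\delta_2x\circ_1y+x\circ_1\delta_2y$. *)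

theory Defs
  imports Complex_Main
begin

text \<open>
  A vector space over a field \<open>'k\<close> of characteristic \<open>0\<close> is a type \<open>'v\<close> with a scalar
  multiplication satisfying the library locale \<^locale>\<open>vector_space\<close>. Linearity is
  \<^locale>\<open>Vector_Spaces.linear\<close>, since the unqualified \<open>linear\<close> and \<open>bilinear\<close> of the library
  concern real vector spaces only.
\<close>

locale bilinear_operation = vector_space scale
  for scale :: "'k::field_char_0 \<Rightarrow> 'v::ab_group_add \<Rightarrow> 'v" +
  fixes f :: "'v \<Rightarrow> 'v \<Rightarrow> 'v"
  assumes linear_right: "Vector_Spaces.linear scale scale (\<lambda>y. f x y)"
    and linear_left: "Vector_Spaces.linear scale scale (\<lambda>x. f x y)"

definition derivation_for :: "('v \<Rightarrow> 'v \<Rightarrow> 'v::ab_group_add) \<Rightarrow> ('v \<Rightarrow> 'v) \<Rightarrow> bool" where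
  "derivation_for f \<delta> \<longleftrightarrow> (\<forall>x y. \<delta> (f x y) = f (\<delta> x) y + f x (\<delta> y))"

definition compatible_derivations ::
    "('v \<Rightarrow> 'v \<Rightarrow> 'v::ab_group_add) \<Rightarrow> ('v \<Rightarrow> 'v \<Rightarrow> 'v) \<Rightarrow> ('v \<Rightarrow> 'v) \<Rightarrow> ('v \<Rightarrow> 'v) \<Rightarrow> bool" where
  "compatible_derivations f\<^sub>1 f\<^sub>2 \<delta>\<^sub>1 \<delta>\<^sub>2 \<longleftrightarrow>
    (\<forall>x y. \<delta>\<^sub>1 (f\<^sub>2 x y) + \<delta>\<^sub>2 (f\<^sub>1 x y) =
      f\<^sub>2 (\<delta>\<^sub>1 x) y + f\<^sub>2 x (\<delta>\<^sub>1 y) + f\<^sub>1 (\<delta>\<^sub>2 x) y + f\<^sub>1 x (\<delta>\<^sub>2 y))"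

locale dendriform_algebra =
  left: bilinear_operation scale l + right: bilinear_operation scale r
  for scale :: "'k::field_char_0 \<Rightarrow> 'v::ab_group_add \<Rightarrow> 'v"
    and l :: "'v \<Rightarrow> 'v \<Rightarrow> 'v" (infixl "\<prec>" 70)
    and r :: "'v \<Rightarrow> 'v \<Rightarrow> 'v" (infixl "\<succ>" 70) +
  assumes dend_left: "(x \<prec> y) \<prec> z = x \<prec> (y \<prec> z + y \<succ> z)"
    and dend_mid: "(x \<succ> y) \<prec> z = x \<succ> (y \<prec> z)"
    and dend_right: "x \<succ> (y \<succ> z) = (x \<prec> y + x \<succ> y) \<succ> z"

locale dendriDer_pair = dendriform_algebra scale l r
  for scale :: "'k::field_char_0 \<Rightarrow> 'v::ab_group_add \<Rightarrow> 'v"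
    and l :: "'v \<Rightarrow> 'v \<Rightarrow> 'v" (infixl "\<prec>" 70)
    and r :: "'v \<Rightarrow> 'v \<Rightarrow> 'v" (infixl "\<succ>" 70) +
  fixes \<delta> :: "'v \<Rightarrow> 'v"
  assumes linear_der: "Vector_Spaces.linear scale scale \<delta>"
    and der_left: "derivation_for (\<prec>) \<delta>"
    and der_right: "derivation_for (\<succ>) \<delta>"

locale compatible_dendriform_algebra =
  D1: dendriform_algebra scale l\<^sub>1 r\<^sub>1 + D2: dendriform_algebra scale l\<^sub>2 r\<^sub>2
  for scale :: "'k::field_char_0 \<Rightarrow> 'v::ab_group_add \<Rightarrow> 'v"
    and l\<^sub>1 :: "'v \<Rightarrow> 'v \<Rightarrow> 'v" (infixl "\<prec>\<^sub>1" 70)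
    and r\<^sub>1 :: "'v \<Rightarrow> 'v \<Rightarrow> 'v" (infixl "\<succ>\<^sub>1" 70)
    and l\<^sub>2 :: "'v \<Rightarrow> 'v \<Rightarrow> 'v" (infixl "\<prec>\<^sub>2" 70)
    and r\<^sub>2 :: "'v \<Rightarrow> 'v \<Rightarrow> 'v" (infixl "\<succ>\<^sub>2" 70) +
  assumes compat_left:
      "(x \<prec>\<^sub>1 y) \<prec>\<^sub>2 z + (x \<prec>\<^sub>2 y) \<prec>\<^sub>1 z =
       x \<prec>\<^sub>2 (y \<prec>\<^sub>1 z + y \<succ>\<^sub>1 z) + x \<prec>\<^sub>1 (y \<prec>\<^sub>2 z + y \<succ>\<^sub>2 z)"
    and compat_mid:
      "(x \<succ>\<^sub>1 y) \<prec>\<^sub>2 z + (x \<succ>\<^sub>2 y) \<prec>\<^sub>1 z = x \<succ>\<^sub>2 (y \<prec>\<^sub>1 z) + x \<succ>\<^sub>1 (y \<prec>\<^sub>2 z)"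
    and compat_right:
      "(x \<prec>\<^sub>1 y + x \<succ>\<^sub>1 y) \<succ>\<^sub>2 z + (x \<prec>\<^sub>2 y + x \<succ>\<^sub>2 y) \<succ>\<^sub>1 z =
       x \<succ>\<^sub>2 (y \<succ>\<^sub>1 z) + x \<succ>\<^sub>1 (y \<succ>\<^sub>2 z)"

locale compatible_dendriDer_pair =
  compatible_dendriform_algebra scale l\<^sub>1 r\<^sub>1 l\<^sub>2 r\<^sub>2 +
  P1: dendriDer_pair scale l\<^sub>1 r\<^sub>1 \<delta>\<^sub>1 + P2: dendriDer_pair scale l\<^sub>2 r\<^sub>2 \<delta>\<^sub>2
  for scale :: "'k::field_char_0 \<Rightarrow> 'v::ab_group_add \<Rightarrow> 'v"
    and l\<^sub>1 :: "'v \<Rightarrow> 'v \<Rightarrow> 'v" (infixl "\<prec>\<^sub>1" 70)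
    and r\<^sub>1 :: "'v \<Rightarrow> 'v \<Rightarrow> 'v" (infixl "\<succ>\<^sub>1" 70)
    and l\<^sub>2 :: "'v \<Rightarrow> 'v \<Rightarrow> 'v" (infixl "\<prec>\<^sub>2" 70)
    and r\<^sub>2 :: "'v \<Rightarrow> 'v \<Rightarrow> 'v" (infixl "\<succ>\<^sub>2" 70)
    and \<delta>\<^sub>1 \<delta>\<^sub>2 :: "'v \<Rightarrow> 'v" +
  assumes compat_der_left: "compatible_derivations (\<prec>\<^sub>1) (\<prec>\<^sub>2) \<delta>\<^sub>1 \<delta>\<^sub>2"
    and compat_der_right: "compatible_derivations (\<succ>\<^sub>1) (\<succ>\<^sub>2) \<delta>\<^sub>1 \<delta>\<^sub>2"

locale pre_Lie_algebra = bilinear_operation scale c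
  for scale :: "'k::field_char_0 \<Rightarrow> 'v::ab_group_add \<Rightarrow> 'v"
    and c :: "'v \<Rightarrow> 'v \<Rightarrow> 'v" (infixl "\<odot>" 70) +
  assumes pre_Lie: "(x \<odot> y) \<odot> z - x \<odot> (y \<odot> z) = (y \<odot> x) \<odot> z - y \<odot> (x \<odot> z)"

locale pre_LieDer_pair = pre_Lie_algebra scale c
  for scale :: "'k::field_char_0 \<Rightarrow> 'v::ab_group_add \<Rightarrow> 'v"
    and c :: "'v \<Rightarrow> 'v \<Rightarrow> 'v" (infixl "\<odot>" 70) +
  fixes \<delta> :: "'v \<Rightarrow> 'v"
  assumes linear_der: "Vector_Spaces.linear scale scale \<delta>"
    and der: "derivation_for (\<odot>) \<delta>"

locale compatible_pre_LieDer_pair =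
  P1: pre_LieDer_pair scale c\<^sub>1 \<delta>\<^sub>1 + P2: pre_LieDer_pair scale c\<^sub>2 \<delta>\<^sub>2
  for scale :: "'k::field_char_0 \<Rightarrow> 'v::ab_group_add \<Rightarrow> 'v"
    and c\<^sub>1 :: "'v \<Rightarrow> 'v \<Rightarrow> 'v" (infixl "\<odot>\<^sub>1" 70)
    and c\<^sub>2 :: "'v \<Rightarrow> 'v \<Rightarrow> 'v" (infixl "\<odot>\<^sub>2" 70)
    and \<delta>\<^sub>1 \<delta>\<^sub>2 :: "'v \<Rightarrow> 'v" +
  assumes compat_pre_Lie:
      "x \<odot>\<^sub>1 (y \<odot>\<^sub>2 z) + x \<odot>\<^sub>2 (y \<odot>\<^sub>1 z) - (x \<odot>\<^sub>2 y) \<odot>\<^sub>1 z - (x \<odot>\<^sub>1 y) \<odot>\<^sub>2 z =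
       y \<odot>\<^sub>1 (x \<odot>\<^sub>2 z) + y \<odot>\<^sub>2 (x \<odot>\<^sub>1 z) - (y \<odot>\<^sub>2 x) \<odot>\<^sub>1 z - (y \<odot>\<^sub>1 x) \<odot>\<^sub>2 z"
    and compat_der: "compatible_derivations (\<odot>\<^sub>1) (\<odot>\<^sub>2) \<delta>\<^sub>1 \<delta>\<^sub>2"

definition pre_Lie_product ::
    "('v \<Rightarrow> 'v \<Rightarrow> 'v::ab_group_add) \<Rightarrow> ('v \<Rightarrow> 'v \<Rightarrow> 'v) \<Rightarrow> 'v \<Rightarrow> 'v \<Rightarrow> 'v" where
  "pre_Lie_product l r x y = r x y - l y x"

end

theory Submission
  imports Defs
begin

text \<open>Write o for \<open>pre_Lie_product l r\<close>. Expanding (x o y) o z - x o (y o z) by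
  bilinearity and applying the three dendriform axioms leaves x \<succ> (z \<prec> y) + y \<succ> (z
  \<prec> x) - (x \<prec> y + y \<prec> x) \<succ> z - z \<prec> (x \<succ> y + y \<succ> x), which
  is symmetric in x and y: this is the pre-Lie identity
  (\<open>pre_Lie_algebra_pre_Lie_product\<close>). Each compatibility condition is the coefficient
  of st in the corresponding identity for s times the first structure plus t times the second. Hence
  the same cancellation, done directly on the mixed terms, gives
  \<open>compatible_pre_Lie_product\<close>. The derivation conditions are linear in the operation,
  so they pass from \<prec> and \<succ> to o.\<close>

context bilinear_operation
begin

text \<open>Gives access to the facts on linear maps from the space to itself, such as
  \<open>linear_diff\<close> and \<open>linear_compose_sub\<close>.\<close>

sublocale vector_space_pair scale scale ..

lemma add_right: "f x (y + z) = f x y + f x z"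
  by (rule linear_add[OF linear_right])

lemma add_left: "f (x + y) z = f x z + f y z"
  by (rule linear_add[OF linear_left])

lemma diff_right: "f x (y - z) = f x y - f x z"
  by (rule linear_diff[OF linear_right])

lemma diff_left: "f (x - y) z = f x z - f y z"
  by (rule linear_diff[OF linear_left])

end

lemma bilinear_operation_pre_Lie_product:
  assumes "bilinear_operation scale l" "bilinear_operation scale r"
  shows "bilinear_operation scale (pre_Lie_product l r)"
proof -
  interpret l: bilinear_operation scale l by fact
  interpret r: bilinear_operation scale r by fact
  show ?thesis
    unfolding pre_Lie_product_def
    by (intro bilinear_operation.intro bilinear_operation_axioms.intro l.vector_space_axioms
        l.linear_compose_sub l.linear_left l.linear_right r.linear_left r.linear_right)
qed

context dendriform_algebra
begin

lemmas distribs = left.add_left left.add_right left.diff_left left.diff_right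
  right.add_left right.add_right right.diff_left right.diff_right

lemma pre_Lie_algebra_pre_Lie_product: "pre_Lie_algebra scale (pre_Lie_product l r)"
proof -
  interpret bilinear_operation scale "pre_Lie_product l r"
    by (intro bilinear_operation_pre_Lie_product left.bilinear_operation_axioms
        right.bilinear_operation_axioms)
  show ?thesis
    \<comment> \<open>As rewrite rules the axioms nest \<prec> to the right, \<succ> to the left,
      and bring mixed products to the form x \<succ> (y \<prec> z), so both associators reach a
      common normal form.\<close>
    by unfold_locales
      (simp add: pre_Lie_product_def distribs dend_left dend_mid dend_right algebra_simps)
qed

end

lemma (in dendriDer_pair) pre_LieDer_pair_pre_Lie_product:
  "pre_LieDer_pair scale (pre_Lie_product l r) \<delta>"
proof -
  interpret pre_Lie_algebra scale "pre_Lie_product l r"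
    by (rule pre_Lie_algebra_pre_Lie_product)
  have "derivation_for (pre_Lie_product l r) \<delta>"
    using der_left der_right
    by (simp add: derivation_for_def pre_Lie_product_def left.linear_diff[OF linear_der] algebra_simps)
  then show ?thesis
    by (intro pre_LieDer_pair.intro pre_LieDer_pair_axioms.intro pre_Lie_algebra_axioms linear_der)
qed

text \<open>Subtract the condition for \<open>l\<^sub>1\<close>, \<open>l\<^sub>2\<close> at (y, x)
  from the one for \<open>r\<^sub>1\<close>, \<open>r\<^sub>2\<close> at (x, y); only the
  compatibility of the two maps with subtraction enters.\<close>

lemma compatible_derivations_pre_Lie_product:
  assumes "\<And>x y. \<delta>\<^sub>1 (x - y) = \<delta>\<^sub>1 x - \<delta>\<^sub>1 y" "\<And>x y. \<delta>\<^sub>2 (x - y) = \<delta>\<^sub>2 x - \<delta>\<^sub>2 y"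
    and "compatible_derivations l\<^sub>1 l\<^sub>2 \<delta>\<^sub>1 \<delta>\<^sub>2" "compatible_derivations r\<^sub>1 r\<^sub>2 \<delta>\<^sub>1 \<delta>\<^sub>2"
  shows "compatible_derivations (pre_Lie_product l\<^sub>1 r\<^sub>1) (pre_Lie_product l\<^sub>2 r\<^sub>2) \<delta>\<^sub>1 \<delta>\<^sub>2"
proof -
  \<comment> \<open>An equation between sums is a poor rewrite rule, so the condition is solved for
    a single term; the remaining \<delta> term then cancels.\<close>
  have l: "\<delta>\<^sub>1 (l\<^sub>2 x y) =
      l\<^sub>2 (\<delta>\<^sub>1 x) y + l\<^sub>2 x (\<delta>\<^sub>1 y) + l\<^sub>1 (\<delta>\<^sub>2 x) y + l\<^sub>1 x (\<delta>\<^sub>2 y) - \<delta>\<^sub>2 (l\<^sub>1 x y)" for x y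
    using assms(3) by (simp add: compatible_derivations_def eq_diff_eq)
  have r: "\<delta>\<^sub>1 (r\<^sub>2 x y) =
      r\<^sub>2 (\<delta>\<^sub>1 x) y + r\<^sub>2 x (\<delta>\<^sub>1 y) + r\<^sub>1 (\<delta>\<^sub>2 x) y + r\<^sub>1 x (\<delta>\<^sub>2 y) - \<delta>\<^sub>2 (r\<^sub>1 x y)" for x y
    using assms(4) by (simp add: compatible_derivations_def eq_diff_eq)
  show ?thesis
    by (simp add: compatible_derivations_def pre_Lie_product_def assms(1,2) l r algebra_simps)
qed

text \<open>Both sides are negated sums of the two mixed associators, and the polarized axioms
  reduce them as in the unmixed case.\<close>

lemma (in compatible_dendriform_algebra) compatible_pre_Lie_product:
  fixes x y z :: 'v
  defines "c\<^sub>1 \<equiv> pre_Lie_product l\<^sub>1 r\<^sub>1" and "c\<^sub>2 \<equiv> pre_Lie_product l\<^sub>2 r\<^sub>2"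
  shows "c\<^sub>1 x (c\<^sub>2 y z) + c\<^sub>2 x (c\<^sub>1 y z) - c\<^sub>1 (c\<^sub>2 x y) z - c\<^sub>2 (c\<^sub>1 x y) z =
    c\<^sub>1 y (c\<^sub>2 x z) + c\<^sub>2 y (c\<^sub>1 x z) - c\<^sub>1 (c\<^sub>2 y x) z - c\<^sub>2 (c\<^sub>1 y x) z"
proof -
  \<comment> \<open>Each mixed axiom is solved for one of its two polarized terms, nested as on the
    rewritten side of the unmixed axiom. The other term survives and cancels against its own
    occurrence in the expansion.\<close>
  have left: "(a \<prec>\<^sub>1 b) \<prec>\<^sub>2 c =
      a \<prec>\<^sub>2 (b \<prec>\<^sub>1 c + b \<succ>\<^sub>1 c) + a \<prec>\<^sub>1 (b \<prec>\<^sub>2 c + b \<succ>\<^sub>2 c) - (a \<prec>\<^sub>2 b) \<prec>\<^sub>1 c" for a b c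
    using compat_left by (simp add: eq_diff_eq)
  have mid: "(a \<succ>\<^sub>1 b) \<prec>\<^sub>2 c =
      a \<succ>\<^sub>2 (b \<prec>\<^sub>1 c) + a \<succ>\<^sub>1 (b \<prec>\<^sub>2 c) - (a \<succ>\<^sub>2 b) \<prec>\<^sub>1 c" for a b c
    using compat_mid by (simp add: eq_diff_eq)
  have right: "a \<succ>\<^sub>1 (b \<succ>\<^sub>2 c) =
      (a \<prec>\<^sub>1 b + a \<succ>\<^sub>1 b) \<succ>\<^sub>2 c + (a \<prec>\<^sub>2 b + a \<succ>\<^sub>2 b) \<succ>\<^sub>1 c - a \<succ>\<^sub>2 (b \<succ>\<^sub>1 c)" for a b c
    using compat_right[of a b c] by (simp add: eq_diff_eq add.commute)
  show ?thesis
    unfolding c\<^sub>1_def c\<^sub>2_def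
    by (simp add: pre_Lie_product_def D1.distribs D2.distribs left mid right algebra_simps)
qed

theorem proposition4p9:
  fixes scale :: "'k::field_char_0 \<Rightarrow> 'v::ab_group_add \<Rightarrow> 'v"
    and l\<^sub>1 r\<^sub>1 l\<^sub>2 r\<^sub>2 :: "'v \<Rightarrow> 'v \<Rightarrow> 'v"
    and \<delta>\<^sub>1 \<delta>\<^sub>2 :: "'v \<Rightarrow> 'v"
  assumes "compatible_dendriDer_pair scale l\<^sub>1 r\<^sub>1 l\<^sub>2 r\<^sub>2 \<delta>\<^sub>1 \<delta>\<^sub>2"
  shows "compatible_pre_LieDer_pair scale
    (pre_Lie_product l\<^sub>1 r\<^sub>1) (pre_Lie_product l\<^sub>2 r\<^sub>2) \<delta>\<^sub>1 \<delta>\<^sub>2"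
proof -
  interpret compatible_dendriDer_pair scale l\<^sub>1 r\<^sub>1 l\<^sub>2 r\<^sub>2 \<delta>\<^sub>1 \<delta>\<^sub>2 by fact
  show ?thesis
  proof (intro compatible_pre_LieDer_pair.intro compatible_pre_LieDer_pair_axioms.intro)
    show "compatible_derivations (pre_Lie_product l\<^sub>1 r\<^sub>1) (pre_Lie_product l\<^sub>2 r\<^sub>2) \<delta>\<^sub>1 \<delta>\<^sub>2"
      using compat_der_left compat_der_right
      by (intro compatible_derivations_pre_Lie_product)
        (simp_all add: D1.left.linear_diff P1.linear_der P2.linear_der)
  qed (rule P1.pre_LieDer_pair_pre_Lie_product P2.pre_LieDer_pair_pre_Lie_product
      compatible_pre_Lie_product)+
qed

end
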